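(* Let $P,Q$ be integers such that the discriminant $D=P^2-4Q$ of the characteristic equation $x^2-Px+Q=0$ associated with the Lucas sequence of first kind $U_n(P,Q)$ is zero. Then $(U_n(P,Q))_{n\in\mathbb{N}}$ is $1$-fold log-concave.
   Context: $\mathbb{N}=\{0,1,2,\dots\}$. For integers $P,Q$ with $P^2-4Q\geq 0$, the Lucas sequence of first kind $U_n=U_n(P,Q)$ is defined by $U_0=0$, $U_1=1$, $U_n=PU_{n-1}-QU_{n-2}$ for $n\geq 2$. Every real sequence $(a_n)_{n\in\mathbb{N}}$ is extended to indices in $\mathbb{Z}$ by the convention $a_n=0$ for $n<0$. The log-operator $\mathcal{L}$ sends a real sequence $(a_n)_{n\in\mathbb{N}}$ to the real sequence $(b_n)_{n\in\mathbb{N}}$ with $b_n=\mathcal{L}(a_n)=a_n^2-a_{n-1}a_{n+1}$ (in particular $b_0=a_0^2$). A real sequence is log-concave, equivalently $1$-fold log-concave, if $\mathcal{L}(a_n)\geq 0$ for all $n\in\mathbb{N}$. *)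

theory Defs
  imports Complex_Main
begin

text \<open>Lucas sequence of the first kind.  The standing condition P^2 - 4Q \<ge> 0 is not needed
  for the recursion and is left to the statements that use it.\<close>

fun lucas_U :: "int \<Rightarrow> int \<Rightarrow> nat \<Rightarrow> int" where
  "lucas_U P Q 0 = 0"
| "lucas_U P Q (Suc 0) = 1"
| "lucas_U P Q (Suc (Suc n)) = P * lucas_U P Q (Suc n) - Q * lucas_U P Q n"

definition zero_ext :: "(nat \<Rightarrow> real) \<Rightarrow> int \<Rightarrow> real" where
  "zero_ext a k = (if k < 0 then 0 else a (nat k))"

text \<open>The indices are integers, so that the left neighbour of index 0 is the index -1, where the
  extended sequence vanishes; truncated subtraction on the naturals would give index 0 instead.\<close>

definition log_operator :: "(nat \<Rightarrow> real) \<Rightarrow> nat \<Rightarrow> real" where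
  "log_operator a n =
     (zero_ext a (int n))\<^sup>2 - zero_ext a (int n - 1) * zero_ext a (int n + 1)"

definition log_concave :: "(nat \<Rightarrow> real) \<Rightarrow> bool" where
  "log_concave a \<longleftrightarrow> (\<forall>n. log_operator a n \<ge> 0)"

end

theory Submission
  imports Defs
begin

text \<open>The log-operator is a Casorati determinant of the recurrence, so from index 1 on each
  shift multiplies it by Q (\<open>lucas_U_Cassini\<close>). Index 0 stands apart: the term at -1
  vanishes, leaving U_0^2 = 0.\<close>

text \<open>Cassini's identity turns the log-operator of the Lucas sequence at index n + 1 into Q^n,
  and a vanishing discriminant forces Q \<ge> 0.\<close>

lemma lucas_U_Cassini:
  "(lucas_U P Q (Suc n))\<^sup>2 - lucas_U P Q n * lucas_U P Q (Suc (Suc n)) = Q ^ n"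
proof (induction n)
  case 0
  then show ?case by simp
next
  case (Suc n)
  \<comment> \<open>The P-terms cancel once U_{n+3} and one factor of U_{n+2}^2 are expanded by the
    recurrence.\<close>
  have "(lucas_U P Q (Suc (Suc n)))\<^sup>2 - lucas_U P Q (Suc n) * lucas_U P Q (Suc (Suc (Suc n)))
      = Q * ((lucas_U P Q (Suc n))\<^sup>2 - lucas_U P Q n * lucas_U P Q (Suc (Suc n)))"
    by (simp add: power2_eq_square algebra_simps)
  then show ?case
    by (simp only: Suc.IH power_Suc)
qed

lemma log_operator_0: "log_operator a 0 = (a 0)\<^sup>2"
  by (simp add: log_operator_def zero_ext_def)

lemma log_operator_Suc: "log_operator a (Suc n) = (a (Suc n))\<^sup>2 - a n * a (Suc (Suc n))"
  by (simp add: log_operator_def zero_ext_def nat_add_distrib)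

lemma log_operator_lucas_U_Suc:
  "log_operator (\<lambda>n. real_of_int (lucas_U P Q n)) (Suc n) = real_of_int (Q ^ n)"
  \<comment> \<open>Cassini is read from right to left, replacing \<open>Q ^ n\<close>; only the
    casts then remain to be distributed.\<close>
  unfolding log_operator_Suc lucas_U_Cassini[of P Q n, symmetric]
  by (simp only: of_int_diff of_int_mult of_int_power)

theorem proposition9:
  fixes P Q :: int
  assumes "P\<^sup>2 - 4 * Q = 0"
  shows "log_concave (\<lambda>n. real_of_int (lucas_U P Q n))"
  unfolding log_concave_def
proof
  fix n
  \<comment> \<open>4Q = P^2 is a square.\<close>
  have "Q \<ge> 0"
    using assms zero_le_power2[of P] by linarith
  then show "log_operator (\<lambda>n. real_of_int (lucas_U P Q n)) n \<ge> 0"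
    by (cases n) (simp_all add: log_operator_0 log_operator_lucas_U_Suc)
qed

end
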